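(* Let $\delta,\kappa\in\{1,i\}$ and $a\in\mathbb{R}$. Let $w(x,y)$ be a solution of $$w_{xx}-\delta^2w_{yy}=\frac{2a}{\kappa}\sinh(2\kappa w),$$ and suppose that $w$ is compatible with $$w_{xy}=F(w)w_xw_y .$$ Then $F(w)$ is of the form $$F(w)=\kappa\tanh(\kappa w)$$ or of the form $$F(w)=\kappa\coth(\kappa w).$$
   Context: Here $i$ is the imaginary unit, $w=w(x,y)$ is a function of two real variables and $F$ is a function of one variable. For $\kappa=1$ the right-hand side of the PDE is $2a\sinh(2w)$ and for $\kappa=i$ it is $2a\sin(2w)$; $\delta^2=1$ gives the wave operator and $\delta^2=-1$ the Laplace operator. Compatibility of the PDE with $w_{xy}=F(w)w_xw_y$ is meant in the usual sense for overdetermined systems: the mixed derivatives $w_{xxxy}$ and $w_{xxyx}$ computed from the two equations by differentiation (and elimination of $w_{xx}$ by means of the PDE) agree identically, as expressions in $w,w_x,w_y,w_{yy}$. The relation $w_{xy}=F(w)w_xw_y$ is the functional separation condition: it corresponds to $f(w(x,y))=A(x)+B(y)$ for an invertible smooth function $f$ with $F=-f''/f'$.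
   Formalization: The constant a is assumed nonzero: for a = 0 the claim fails, since F = 0 is compatible with w_xx = δ² w_yy (for example w = x + y) but is neither κ tanh(κw) nor κ coth(κw). *)

theory Defs
  imports "HOL-Analysis.Analysis"
begin

definition coth :: "'a :: {banach, real_normed_field} \<Rightarrow> 'a" where
  "coth z = cosh z / sinh z"

definition pd_x :: "(real \<Rightarrow> real \<Rightarrow> real) \<Rightarrow> real \<Rightarrow> real \<Rightarrow> real" where
  "pd_x w x y = deriv (\<lambda>s. w s y) x"

definition pd_y :: "(real \<Rightarrow> real \<Rightarrow> real) \<Rightarrow> real \<Rightarrow> real \<Rightarrow> real" where
  "pd_y w x y = deriv (\<lambda>s. w x s) y"

definition twice_differentiable2 :: "(real \<Rightarrow> real \<Rightarrow> real) \<Rightarrow> (real \<times> real) set \<Rightarrow> bool" where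
  "twice_differentiable2 w U \<longleftrightarrow>
     case_prod w differentiable_on U \<and>
     case_prod (pd_x w) differentiable_on U \<and>
     case_prod (pd_y w) differentiable_on U"

text \<open>The right-hand side of the PDE. It is real for \<open>\<kappa> \<in> {1, \<i>}\<close>, namely
  \<open>2 a sinh (2 v)\<close> or \<open>2 a sin (2 v)\<close>.\<close>

definition pde_rhs :: "real \<Rightarrow> complex \<Rightarrow> real \<Rightarrow> complex" where
  "pde_rhs a \<kappa> v = 2 * complex_of_real a / \<kappa> * sinh (2 * \<kappa> * complex_of_real v)"

definition solves_pde ::
  "real \<Rightarrow> complex \<Rightarrow> complex \<Rightarrow> (real \<Rightarrow> real \<Rightarrow> real) \<Rightarrow> (real \<times> real) set \<Rightarrow> bool" where
  "solves_pde a \<kappa> \<delta> w U \<longleftrightarrow> (\<forall>(x, y) \<in> U.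
     complex_of_real (pd_x (pd_x w) x y) - \<delta>\<^sup>2 * complex_of_real (pd_y (pd_y w) x y)
       = pde_rhs a \<kappa> (w x y))"

definition solves_separation ::
  "(real \<Rightarrow> real) \<Rightarrow> (real \<Rightarrow> real \<Rightarrow> real) \<Rightarrow> (real \<times> real) set \<Rightarrow> bool" where
  "solves_separation F w U \<longleftrightarrow> (\<forall>(x, y) \<in> U.
     pd_y (pd_x w) x y = F (w x y) * pd_x w x y * pd_y w x y)"

text \<open>
  Differential expressions in the independent variables \<open>v, p, q, t\<close>, which stand for
  \<open>w, w\<^sub>x, w\<^sub>y, w\<^sub>y\<^sub>y\<close>: modulo the two equations and their
  derivatives, every derivative of \<open>w\<close> is such an expression. Only \<open>\<delta>\<close> and \<open>\<kappa>\<close> make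
  the values formally complex.
\<close>

type_synonym jet_expr = "real \<Rightarrow> real \<Rightarrow> real \<Rightarrow> real \<Rightarrow> complex"

text \<open>Chain rule: the derivative of \<open>H\<close> in a direction in which the derivatives of
  \<open>w, w\<^sub>x, w\<^sub>y, w\<^sub>y\<^sub>y\<close> are \<open>V, P, Q, T\<close>.\<close>

definition total_deriv ::
  "jet_expr \<Rightarrow> jet_expr \<Rightarrow> jet_expr \<Rightarrow> jet_expr \<Rightarrow> jet_expr \<Rightarrow> jet_expr" where
  "total_deriv V P Q T H v p q t =
     vector_derivative (\<lambda>s. H s p q t) (at v) * V v p q t +
     vector_derivative (\<lambda>s. H v s q t) (at p) * P v p q t +
     vector_derivative (\<lambda>s. H v p s t) (at q) * Q v p q t +
     vector_derivative (\<lambda>s. H v p q s) (at t) * T v p q t"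

definition jet_x :: jet_expr where
  "jet_x v p q t = complex_of_real p"

definition jet_y :: jet_expr where
  "jet_y v p q t = complex_of_real q"

definition jet_yy :: jet_expr where
  "jet_yy v p q t = complex_of_real t"

definition jet_xx :: "real \<Rightarrow> complex \<Rightarrow> complex \<Rightarrow> jet_expr" where
  "jet_xx a \<kappa> \<delta> v p q t = \<delta>\<^sup>2 * complex_of_real t + pde_rhs a \<kappa> v"

definition jet_xy :: "(real \<Rightarrow> real) \<Rightarrow> jet_expr" where
  "jet_xy F v p q t = complex_of_real (F v * p * q)"

text \<open>The third derivatives \<open>w\<^sub>x\<^sub>x\<^sub>y\<close> and \<open>w\<^sub>x\<^sub>y\<^sub>y\<close> come from
  differentiating \<open>w\<^sub>x\<^sub>y = F(w) w\<^sub>x w\<^sub>y\<close> in \<open>x\<close> and \<open>y\<close>; as the right-hand side does not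
  involve \<open>w\<^sub>y\<^sub>y\<close>, the derivative of \<open>w\<^sub>y\<^sub>y\<close> is irrelevant there and set to \<open>0\<close>.
  The third derivative \<open>w\<^sub>y\<^sub>y\<^sub>y\<close> comes from the \<open>y\<close>-derivative of the PDE,
  \<open>w\<^sub>x\<^sub>x\<^sub>y = \<delta>\<^sup>2 w\<^sub>y\<^sub>y\<^sub>y + pde_rhs'(w) w\<^sub>y\<close>.\<close>

definition jet_xxy :: "real \<Rightarrow> complex \<Rightarrow> complex \<Rightarrow> (real \<Rightarrow> real) \<Rightarrow> jet_expr" where
  "jet_xxy a \<kappa> \<delta> F =
     total_deriv jet_x (jet_xx a \<kappa> \<delta>) (jet_xy F) (\<lambda>v p q t. 0) (jet_xy F)"

definition jet_xyy :: "(real \<Rightarrow> real) \<Rightarrow> jet_expr" where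
  "jet_xyy F = total_deriv jet_y (jet_xy F) jet_yy (\<lambda>v p q t. 0) (jet_xy F)"

definition jet_yyy :: "real \<Rightarrow> complex \<Rightarrow> complex \<Rightarrow> (real \<Rightarrow> real) \<Rightarrow> jet_expr" where
  "jet_yyy a \<kappa> \<delta> F v p q t =
     (jet_xxy a \<kappa> \<delta> F v p q t
        - vector_derivative (pde_rhs a \<kappa>) (at v) * complex_of_real q) / \<delta>\<^sup>2"

definition total_x :: "real \<Rightarrow> complex \<Rightarrow> complex \<Rightarrow> (real \<Rightarrow> real) \<Rightarrow> jet_expr \<Rightarrow> jet_expr" where
  "total_x a \<kappa> \<delta> F = total_deriv jet_x (jet_xx a \<kappa> \<delta>) (jet_xy F) (jet_xyy F)"

definition total_y :: "real \<Rightarrow> complex \<Rightarrow> complex \<Rightarrow> (real \<Rightarrow> real) \<Rightarrow> jet_expr \<Rightarrow> jet_expr" where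
  "total_y a \<kappa> \<delta> F = total_deriv jet_y (jet_xy F) jet_yy (jet_yyy a \<kappa> \<delta> F)"

text \<open>\<open>w\<^sub>x\<^sub>x\<^sub>x\<^sub>y = w\<^sub>x\<^sub>x\<^sub>y\<^sub>x\<close> as an identity between expressions, for
  \<open>w\<close> in the domain \<open>J\<close> of \<open>F\<close> and arbitrary \<open>w\<^sub>x, w\<^sub>y, w\<^sub>y\<^sub>y\<close>.\<close>

definition pde_separation_compatible ::
  "real \<Rightarrow> complex \<Rightarrow> complex \<Rightarrow> (real \<Rightarrow> real) \<Rightarrow> real set \<Rightarrow> bool" where
  "pde_separation_compatible a \<kappa> \<delta> F J \<longleftrightarrow> (\<forall>v \<in> J. \<forall>p q t.
     total_y a \<kappa> \<delta> F (total_x a \<kappa> \<delta> F (jet_xx a \<kappa> \<delta>)) v p q t =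
     total_x a \<kappa> \<delta> F (jet_xxy a \<kappa> \<delta> F) v p q t)"

end

theory Submission
  imports Defs
begin

text \<open>
  Put \<open>K = F' + F\<^sup>2\<close> and let \<open>G\<close> be the right-hand side of the PDE. The two mixed derivatives
  differ by \<open>w\<^sub>x w\<^sub>y (K'(w) (\<delta>\<^sup>2 w\<^sub>y\<^sup>2 - w\<^sub>x\<^sup>2) + G'' + F\<^sup>2 G - 3 K G - F G')\<close>. Hence \<open>K\<close> is a
  constant \<open>k\<close>, and \<open>(4 \<kappa>\<^sup>2 - 3 k + F\<^sup>2) G = F G'\<close>. Together with its derivative this is a
  homogeneous linear system for the nonzero vector \<open>(G, G')\<close>, and its determinant vanishes
  only if \<open>k = \<kappa>\<^sup>2\<close> or \<open>2 F\<^sup>2 = 3 k - 4 \<kappa>\<^sup>2\<close>; the latter makes \<open>F\<close> constant, which is impossible.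
  For \<open>k = \<kappa>\<^sup>2\<close> the relation factors as
  \<open>(F cosh \<kappa>w - \<kappa> sinh \<kappa>w) (F sinh \<kappa>w - \<kappa> cosh \<kappa>w) = 0\<close>. The two factors have no
  common zero, so on an interval one of them vanishes identically.
\<close>

section \<open>Evaluating the compatibility condition on jets\<close>

text \<open>Brings the formally complex jet calculus down to real derivatives. Agreement of
  \<open>H\<close> with \<open>h\<close> over the open set \<open>J\<close> fixes the partial
  derivative in \<open>v\<close>; the other three partials keep \<open>v\<close> inside
  \<open>J\<close>.\<close>

lemma total_deriv_of_real:
  assumes "open J" "v \<in> J"
    and H: "\<And>u p q t. u \<in> J \<Longrightarrow> H u p q t = complex_of_real (h u p q t)"
    and "((\<lambda>s. h s p q t) has_real_derivative hv) (at v)"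
    and "((\<lambda>s. h v s q t) has_real_derivative hp) (at p)"
    and "((\<lambda>s. h v p s t) has_real_derivative hq) (at q)"
    and "((\<lambda>s. h v p q s) has_real_derivative ht) (at t)"
    and "V v p q t = complex_of_real V0" "P v p q t = complex_of_real P0"
    and "Q v p q t = complex_of_real Q0" "T v p q t = complex_of_real T0"
  shows "total_deriv V P Q T H v p q t = complex_of_real (hv * V0 + hp * P0 + hq * Q0 + ht * T0)"
proof -
  have "((\<lambda>s. H s p q t) has_vector_derivative of_real hv) (at v)"
    by (rule has_vector_derivative_transform_within_open[OF
          has_vector_derivative_of_real[OF assms(4)] assms(1,2)])
      (simp add: H)
  moreover have "((\<lambda>s. H v s q t) has_vector_derivative of_real hp) (at p)"
    using has_vector_derivative_of_real[OF assms(5)]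
    by (simp add: H[OF \<open>v \<in> J\<close>])
  moreover have "((\<lambda>s. H v p s t) has_vector_derivative of_real hq) (at q)"
    using has_vector_derivative_of_real[OF assms(6)]
    by (simp add: H[OF \<open>v \<in> J\<close>])
  moreover have "((\<lambda>s. H v p q s) has_vector_derivative of_real ht) (at t)"
    using has_vector_derivative_of_real[OF assms(7)]
    by (simp add: H[OF \<open>v \<in> J\<close>])
  ultimately show ?thesis
    unfolding total_deriv_def using assms(8-11) by (simp add: vector_derivative_at)
qed

text \<open>Since w_x and w_y are arbitrary, the single polynomial identity at \<open>v\<close>
  splits into its coefficients. Here \<open>g\<close> is the right-hand side of the PDE as a real
  function and \<open>d\<close> is the real value of \<delta> squared.\<close>

lemma compatible_imp_ode:
  fixes F F1 F2 g g1 g2 :: "real \<Rightarrow> real" and d :: real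
  assumes J: "open J" and v: "v \<in> J"
    and F: "\<And>u. u \<in> J \<Longrightarrow> (F has_real_derivative F1 u) (at u)"
    and F1: "\<And>u. u \<in> J \<Longrightarrow> (F1 has_real_derivative F2 u) (at u)"
    and g: "\<And>u. (g has_real_derivative g1 u) (at u)"
    and g1: "\<And>u. (g1 has_real_derivative g2 u) (at u)"
    and rhs: "pde_rhs a \<kappa> = (\<lambda>u. complex_of_real (g u))"
    and d: "\<delta>\<^sup>2 = complex_of_real d" "d \<noteq> 0"
    and compatible: "pde_separation_compatible a \<kappa> \<delta> F J"
  shows "F2 v + 2 * F v * F1 v = 0"
    and "g2 v + (F v)\<^sup>2 * g v - 3 * (F1 v + (F v)\<^sup>2) * g v - F v * g1 v = 0"
proof -
  \<comment> \<open>Differentiating w_xy = F w_x w_y and substituting the equation back pairs F'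
    with the square of F.\<close>
  define K where "K u = F1 u + (F u)\<^sup>2" for u
  define K1 where "K1 u = F2 u + 2 * F u * F1 u" for u
  have K: "(K has_real_derivative K1 u) (at u)" if "u \<in> J" for u
    unfolding K_def K1_def
    by (auto intro!: derivative_eq_intros F F1 that)
  have drhs: "vector_derivative (pde_rhs a \<kappa>) (at u) = complex_of_real (g1 u)" for u
    unfolding rhs
    by (intro vector_derivative_at has_vector_derivative_of_real g)
  have xx: "jet_xx a \<kappa> \<delta> u p q t = of_real (d * t + g u)" for u p q t
    by (simp add: jet_xx_def rhs d)
  have xy: "jet_xy F u p q t = of_real (F u * p * q)" for u p q t
    by (simp add: jet_xy_def)
  have xxy: "jet_xxy a \<kappa> \<delta> F u p q t = of_real (K u * p\<^sup>2 * q + F u * (d * t + g u) * q)"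
    if "u \<in> J" for u p q t
    unfolding jet_xxy_def
    by (subst total_deriv_of_real[where h = "\<lambda>u p q t. F u * p * q" and J = J
          and hv = "F1 u * p * q" and hp = "F u * q" and hq = "F u * p" and ht = 0
          and ?V0.0 = p and ?P0.0 = "d * t + g u" and ?Q0.0 = "F u * p * q" and ?T0.0 = 0])
      (auto intro!: derivative_eq_intros F J that
        simp: xy xx jet_x_def K_def algebra_simps power2_eq_square simp del: of_real_add of_real_mult)
  have xyy: "jet_xyy F u p q t = of_real (K u * p * q\<^sup>2 + F u * p * t)"
    if "u \<in> J" for u p q t
    unfolding jet_xyy_def
    by (subst total_deriv_of_real[where h = "\<lambda>u p q t. F u * p * q" and J = J
          and hv = "F1 u * p * q" and hp = "F u * q" and hq = "F u * p" and ht = 0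
          and ?V0.0 = q and ?P0.0 = "F u * p * q" and ?Q0.0 = t and ?T0.0 = 0])
      (auto intro!: derivative_eq_intros F J that
        simp: xy xx jet_y_def jet_yy_def K_def algebra_simps power2_eq_square
        simp del: of_real_add of_real_mult)
  have yyy: "jet_yyy a \<kappa> \<delta> F u p q t =
      of_real ((K u * p\<^sup>2 * q + F u * (d * t + g u) * q - g1 u * q) / d)"
    if "u \<in> J" for u p q t
    unfolding jet_yyy_def by (simp add: xxy that drhs d)
  have xxx: "total_x a \<kappa> \<delta> F (jet_xx a \<kappa> \<delta>) u p q t =
      of_real (g1 u * p + d * (K u * p * q\<^sup>2 + F u * p * t))"
    if "u \<in> J" for u p q t
    unfolding total_x_def
    by (subst total_deriv_of_real[where h = "\<lambda>u p q t. d * t + g u" and J = J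
          and hv = "g1 u" and hp = 0 and hq = 0 and ht = d
          and ?V0.0 = p and ?P0.0 = "d * t + g u" and ?Q0.0 = "F u * p * q"
          and ?T0.0 = "K u * p * q\<^sup>2 + F u * p * t"])
      (auto intro!: derivative_eq_intros g J that
        simp: xy xx xyy[OF that] jet_x_def simp del: of_real_add of_real_mult)
  \<comment> \<open>The summands are the partials of w_xxx in \<open>v\<close>, \<open>p\<close>,
    \<open>q\<close>, \<open>t\<close> times w_y, w_xy, w_yy, w_yyy, left unexpanded so that
    \<open>rule\<close> can unify with \<open>total_deriv_of_real\<close>.\<close>
  have xxxy: "total_y a \<kappa> \<delta> F (total_x a \<kappa> \<delta> F (jet_xx a \<kappa> \<delta>)) v p q t = of_real (
      (g2 v * p + d * (K1 v * p * q\<^sup>2 + F1 v * p * t)) * q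
      + (g1 v + d * (K v * q\<^sup>2 + F v * t)) * (F v * p * q)
      + d * (2 * K v * p * q) * t
      + d * (F v * p) * ((K v * p\<^sup>2 * q + F v * (d * t + g v) * q - g1 v * q) / d))" for p q t
    unfolding total_y_def
    by (rule total_deriv_of_real[where J = J
          and h = "\<lambda>u p q t. g1 u * p + d * (K u * p * q\<^sup>2 + F u * p * t)"])
      (auto intro!: derivative_eq_intros F K g1 J v
        simp: xxx xy yyy[OF v] jet_y_def jet_yy_def simp del: of_real_add of_real_mult)
  have xxyx: "total_x a \<kappa> \<delta> F (jet_xxy a \<kappa> \<delta> F) v p q t = of_real (
      (K1 v * p\<^sup>2 * q + (F1 v * (d * t + g v) + F v * g1 v) * q) * p
      + 2 * K v * p * q * (d * t + g v)
      + (K v * p\<^sup>2 + F v * (d * t + g v)) * (F v * p * q)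
      + F v * d * q * (K v * p * q\<^sup>2 + F v * p * t))" for p q t
    unfolding total_x_def
    by (rule total_deriv_of_real[where J = J
          and h = "\<lambda>u p q t. K u * p\<^sup>2 * q + F u * (d * t + g u) * q"])
      (auto intro!: derivative_eq_intros F K g J v
        simp: xx xxy xy xyy[OF v] jet_x_def algebra_simps simp del: of_real_add of_real_mult)
  define R where "R = g2 v + (F v)\<^sup>2 * g v - 3 * K v * g v - F v * g1 v"
  have main: "p * q * (K1 v * (d * q\<^sup>2 - p\<^sup>2) + R) = 0" for p q
  proof -
    \<comment> \<open>All terms with w_yy cancel in the difference, so setting \<open>t\<close> to 0
      loses nothing.\<close>
    have eq: "total_y a \<kappa> \<delta> F (total_x a \<kappa> \<delta> F (jet_xx a \<kappa> \<delta>)) v p q 0 =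
        total_x a \<kappa> \<delta> F (jet_xxy a \<kappa> \<delta> F) v p q 0"
      using compatible v unfolding pde_separation_compatible_def by blast
    \<comment> \<open>Removes the division that came in with w_yyy, leaving a ring identity for
      \<open>algebra\<close>.\<close>
    have cancel: "d * y * (z / d) = y * z" for y z :: real using d by simp
    show ?thesis
      using eq unfolding xxxy xxyx of_real_eq_iff cancel R_def K_def
      by algebra
  qed
  \<comment> \<open>Two choices of (w_x, w_y) with the same w_x separate \<open>K1 v\<close> from
    \<open>R\<close>.\<close>
  have "K1 v * (d - 1) + R = 0" "K1 v * (4 * d - 1) + R = 0"
    using main[of 1 1] main[of 1 2] by (simp_all add: algebra_simps)
  then have "3 * d * K1 v = 0" by algebra
  then have "K1 v = 0" using d by simp
  then show "F2 v + 2 * F v * F1 v = 0" by (simp add: K1_def)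
  show "g2 v + (F v)\<^sup>2 * g v - 3 * (F1 v + (F v)\<^sup>2) * g v - F v * g1 v = 0"
    using \<open>K1 v = 0\<close> \<open>K1 v * (d - 1) + R = 0\<close> by (simp add: R_def K_def)
qed

section \<open>Solving the ordinary differential relations for F\<close>

text \<open>In the application \<open>S\<close> is sinh(2\<kappa>w)/\<kappa>, \<open>C\<close> is
  cosh(2\<kappa>w) and \<open>e\<close> is \<kappa> squared. Any \<open>k\<close> other than
  \<open>e\<close> would force F to be constant, which contradicts \<open>rel\<close>, the Riccati
  equation or \<open>SC\<close>.\<close>

lemma riccati_constant:
  fixes F F1 S C :: "real \<Rightarrow> real" and e k :: real
  assumes J: "open J" "J \<noteq> {}" and e: "e\<^sup>2 = 1"
    and F: "\<And>u. u \<in> J \<Longrightarrow> (F has_real_derivative F1 u) (at u)"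
    and riccati: "\<And>u. u \<in> J \<Longrightarrow> F1 u = k - (F u)\<^sup>2"
    and S: "\<And>u. (S has_real_derivative 2 * C u) (at u)"
    and C: "\<And>u. (C has_real_derivative 2 * e * S u) (at u)"
    and SC: "\<And>u. (C u)\<^sup>2 - e * (S u)\<^sup>2 = 1"
    and rel: "\<And>u. u \<in> J \<Longrightarrow> (4 * e - 3 * k + (F u)\<^sup>2) * S u = 2 * F u * C u"
  shows "k = e"
proof (rule ccontr)
  assume "k \<noteq> e"
  \<comment> \<open>Allows identities that hold throughout \<open>J\<close> to be
    differentiated.\<close>
  have zero: "D = 0" if "u \<in> J" "(h has_real_derivative D) (at u)"
    "\<And>u. u \<in> J \<Longrightarrow> h u = c" for h :: "real \<Rightarrow> real" and u D c
    using has_field_derivative_transform_within_open[OF that(2) J(1) that(1), of "\<lambda>_. c"]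
      that(3) DERIV_unique[OF _ DERIV_const] by blast
  have sq: "2 * (F u)\<^sup>2 = 3 * k - 4 * e" if u: "u \<in> J" for u
  proof -
    have "2 * F u * F1 u * S u + (4 * e - 3 * k + (F u)\<^sup>2) * (2 * C u)
        - (2 * F1 u * C u + 2 * F u * (2 * e * S u)) = 0"
      by (rule zero[OF u, where h = "\<lambda>u. (4 * e - 3 * k + (F u)\<^sup>2) * S u - 2 * F u * C u"
            and c = 0])
        (auto intro!: derivative_eq_intros F S C u simp: rel)
    then have lin: "F u * (k - (F u)\<^sup>2 - 2 * e) * S u + (4 * e - 4 * k + 2 * (F u)\<^sup>2) * C u = 0"
      unfolding riccati[OF u] by algebra
    \<comment> \<open>Minus the determinant of the system \<open>rel\<close>, \<open>lin\<close> in
      the unknowns (\<open>S u\<close>, \<open>C u\<close>), which \<open>SC\<close> keeps from both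
      vanishing.\<close>
    define D where "D = 4 * (k - e) * (2 * (F u)\<^sup>2 + 4 * e - 3 * k)"
    have "D * S u = 0" "D * C u = 0"
      unfolding D_def using lin rel[OF u] by algebra+
    then have "D = 0" using SC[of u] by auto
    then show ?thesis using \<open>k \<noteq> e\<close> by (simp add: D_def)
  qed
  have FF1: "F u * F1 u = 0" if u: "u \<in> J" for u
  proof -
    have "4 * F u * F1 u = 0"
      by (rule zero[OF u, where h = "\<lambda>u. 2 * (F u)\<^sup>2"])
        (auto intro!: derivative_eq_intros F u sq)
    then show ?thesis by simp
  qed
  obtain u where u: "u \<in> J" using J by blast
  show False
  proof (cases "F u = 0")
    case True
    then have "3 * k = 4 * e" using sq[OF u] by simp
    \<comment> \<open>\<open>sq\<close> spreads the zero at \<open>u\<close> to all of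
      \<open>J\<close>, so the derivative vanishes as well.\<close>
    then have "F x = 0" if "x \<in> J" for x using sq[OF that] by simp
    then have "F1 u = 0" using zero[OF u F[OF u]] by blast
    then have "k = 0" using riccati[OF u] True by simp
    then show False using \<open>3 * k = 4 * e\<close> e by simp
  next
    case False
    then have "k = (F u)\<^sup>2" using FF1[OF u] riccati[OF u] by simp
    then have k: "k = 4 * e" and F2: "(F u)\<^sup>2 = 4 * e" using sq[OF u] by simp_all
    \<comment> \<open>Squaring this makes the left side of \<open>SC\<close> zero.\<close>
    have "- 4 * e * S u = 2 * F u * C u" using rel[OF u] k F2 by simp
    then have "16 * e\<^sup>2 * (S u)\<^sup>2 = 4 * (F u)\<^sup>2 * (C u)\<^sup>2" by algebra
    then have "(S u)\<^sup>2 = e * (C u)\<^sup>2" using e F2 by simp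
    then have "e * (S u)\<^sup>2 = (C u)\<^sup>2" using e by algebra
    then show False using SC[of u] by simp
  qed
qed

text \<open>The two zero sets are relatively closed, disjoint and cover \<open>J\<close>, so
  connectedness leaves one of them empty.\<close>

lemma product_zero_dichotomy:
  fixes A B :: "real \<Rightarrow> real"
  assumes "connected J" "continuous_on J A" "continuous_on J B"
    and "\<And>u. u \<in> J \<Longrightarrow> A u * B u = 0"
    and "\<And>u. u \<in> J \<Longrightarrow> A u \<noteq> 0 \<or> B u \<noteq> 0"
  shows "(\<forall>u\<in>J. A u = 0) \<or> (\<forall>u\<in>J. B u = 0)"
proof -
  let ?Z = "\<lambda>f. {u \<in> J. f u \<in> {0::real}}"
  have "closedin (top_of_set J) (?Z A)" "closedin (top_of_set J) (?Z B)"
    using assms(2,3) continuous_closedin_preimage[of J _ "{0}"]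
    by (auto simp: vimage_def Int_def)
  moreover have "J \<subseteq> ?Z A \<union> ?Z B" "?Z A \<inter> ?Z B = {}" using assms(4,5) by auto
  ultimately have "?Z A = {} \<or> ?Z B = {}"
    using assms(1) unfolding connected_closedin by blast
  then show ?thesis using assms(4) by auto
qed

section \<open>Real form for both values of \<kappa>, and the conclusion\<close>

text \<open>Treats both cases at once: \<open>c\<close> is cosh(\<kappa>u) and \<open>s\<close> is
  sinh(\<kappa>u)/\<kappa>, where the division by \<kappa> makes \<open>s\<close> real. The pair is
  cosh, sinh for \<open>e\<close> = 1 and cos, sin for \<open>e\<close> = -1.\<close>

lemma real_trig_pair:
  assumes "\<kappa> \<in> {1, \<i>}"
  obtains c s :: "real \<Rightarrow> real" and e :: real
  where "e\<^sup>2 = 1" "\<kappa>\<^sup>2 = of_real e"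
    and "\<And>u. (c has_real_derivative e * s u) (at u)"
    and "\<And>u. (s has_real_derivative c u) (at u)"
    and "\<And>u. (c u)\<^sup>2 - e * (s u)\<^sup>2 = 1"
    and "\<And>u. cosh (\<kappa> * complex_of_real u) = of_real (c u)"
    and "\<And>u. sinh (\<kappa> * complex_of_real u) = \<kappa> * of_real (s u)"
proof (cases "\<kappa> = 1")
  case True
  have "cosh (complex_of_real u) = of_real (cosh u)" "sinh (complex_of_real u) = of_real (sinh u)" for u
    by (simp_all add: cosh_field_def sinh_field_def exp_minus exp_of_real)
  then show ?thesis
    by (intro that[of 1 cosh sinh])
      (auto intro!: derivative_eq_intros simp: True cosh_square_eq)
next
  case False
  then have i: "\<kappa> = \<i>" using assms by simp
  show ?thesis
    by (rule that[of "-1" cos sin])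
      (auto intro!: derivative_eq_intros
        simp: i cosh_conv_cos sinh_conv_sin cos_of_real sin_of_real)
qed

theorem proposition3:
  fixes \<delta> \<kappa> :: complex and a :: real
    and w :: "real \<Rightarrow> real \<Rightarrow> real" and U :: "(real \<times> real) set"
    and F :: "real \<Rightarrow> real" and J :: "real set"
  assumes "\<delta> \<in> {1, \<i>}" and "\<kappa> \<in> {1, \<i>}" and "a \<noteq> 0"
    and "open U" and "U \<noteq> {}" and "twice_differentiable2 w U"
    and "open J" and "is_interval J"
    and "F differentiable_on J" and "deriv F differentiable_on J"
    and "\<forall>(x, y) \<in> U. w x y \<in> J"
    and "solves_pde a \<kappa> \<delta> w U"
    and "solves_separation F w U"
    and "pde_separation_compatible a \<kappa> \<delta> F J"
  shows "(\<forall>v \<in> J. cosh (\<kappa> * complex_of_real v) \<noteq> 0 \<and>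
            complex_of_real (F v) = \<kappa> * tanh (\<kappa> * complex_of_real v)) \<or>
         (\<forall>v \<in> J. sinh (\<kappa> * complex_of_real v) \<noteq> 0 \<and>
            complex_of_real (F v) = \<kappa> * coth (\<kappa> * complex_of_real v))"
proof -
  obtain c s :: "real \<Rightarrow> real" and e where e: "e\<^sup>2 = 1" "\<kappa>\<^sup>2 = of_real e"
    and c: "\<And>u. (c has_real_derivative e * s u) (at u)"
    and s: "\<And>u. (s has_real_derivative c u) (at u)"
    and cs: "\<And>u. (c u)\<^sup>2 - e * (s u)\<^sup>2 = 1"
    and cosh: "\<And>u. cosh (\<kappa> * complex_of_real u) = of_real (c u)"
    and sinh: "\<And>u. sinh (\<kappa> * complex_of_real u) = \<kappa> * of_real (s u)"
    using real_trig_pair[OF assms(2)] by metis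
  have \<kappa>: "\<kappa> \<noteq> 0" using assms(2) by auto
  \<comment> \<open>By the double-angle formulas these are sinh(2\<kappa>u)/\<kappa> and
    cosh(2\<kappa>u).\<close>
  define S where "S u = 2 * s u * c u" for u
  define C where "C u = (c u)\<^sup>2 + e * (s u)\<^sup>2" for u
  have S: "(S has_real_derivative 2 * C u) (at u)" for u
    unfolding S_def C_def
    by (auto intro!: derivative_eq_intros c s simp: algebra_simps power2_eq_square)
  have C: "(C has_real_derivative 2 * e * S u) (at u)" for u
    unfolding S_def C_def
    by (auto intro!: derivative_eq_intros c s simp: algebra_simps power2_eq_square)
  have SC: "(C u)\<^sup>2 - e * (S u)\<^sup>2 = 1" for u
    unfolding S_def C_def using cs[of u] by algebra
  have rhs: "pde_rhs a \<kappa> = (\<lambda>u. complex_of_real (2 * a * S u))"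
  proof
    fix u
    have "sinh (2 * \<kappa> * complex_of_real u) = 2 * (\<kappa> * of_real (s u)) * of_real (c u)"
      using sinh_double[of "\<kappa> * complex_of_real u"] by (simp add: cosh sinh mult.assoc)
    then show "pde_rhs a \<kappa> u = of_real (2 * a * S u)"
      using \<kappa> by (simp add: pde_rhs_def S_def)
  qed
  obtain d where d: "\<delta>\<^sup>2 = complex_of_real d" "d \<noteq> 0"
  proof
    show "\<delta>\<^sup>2 = complex_of_real (if \<delta> = 1 then 1 else -1)" using assms(1) by auto
  qed simp
  have F: "(F has_real_derivative deriv F u) (at u)" if "u \<in> J" for u
    using assms(7,9) that differentiable_on_eq_differentiable_at DERIV_deriv_iff_real_differentiable
    by blast
  have F1: "(deriv F has_real_derivative deriv (deriv F) u) (at u)" if "u \<in> J" for u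
    using assms(7,10) that differentiable_on_eq_differentiable_at DERIV_deriv_iff_real_differentiable
    by blast
  have g: "((\<lambda>u. 2 * a * S u) has_real_derivative 4 * a * C u) (at u)" for u
    by (auto intro!: derivative_eq_intros S)
  have g1: "((\<lambda>u. 4 * a * C u) has_real_derivative 8 * a * e * S u) (at u)" for u
    by (auto intro!: derivative_eq_intros C)
  note ode = compatible_imp_ode[OF assms(7) _ F F1 g g1 rhs d assms(14)]
  \<comment> \<open>\<open>J\<close> contains the values of \<open>w\<close> on the nonempty set
    \<open>U\<close>.\<close>
  have J: "connected J" "J \<noteq> {}"
    using assms(5,8,11) is_interval_connected by auto
  have "\<exists>k. \<forall>u\<in>J. deriv F u + (F u)\<^sup>2 = k"
  proof -
    have "((\<lambda>u. deriv F u + (F u)\<^sup>2) has_real_derivative 0) (at u within J)" if "u \<in> J" for u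
      using ode(1)[OF that]
      by (auto intro!: derivative_eq_intros DERIV_subset[OF F] DERIV_subset[OF F1] that simp: mult_ac)
    then show ?thesis
      using has_field_derivative_zero_constant[of J "\<lambda>u. deriv F u + (F u)\<^sup>2"] assms(8)
      by (metis is_interval_convex)
  qed
  then obtain k where k: "\<And>u. u \<in> J \<Longrightarrow> deriv F u + (F u)\<^sup>2 = k" by blast
  have rel: "(4 * e - 3 * k + (F u)\<^sup>2) * S u = 2 * F u * C u" if "u \<in> J" for u
  proof -
    \<comment> \<open>The second equation carries the factor 2a; dividing by it is where
      \<open>a\<close> must be nonzero.\<close>
    have "2 * a * ((4 * e - 3 * k + (F u)\<^sup>2) * S u - 2 * F u * C u) = 0"
      using ode(2)[OF that] unfolding k[OF that] by algebra
    then show ?thesis using assms(3) by simp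
  qed
  have "k = e"
    by (rule riccati_constant[OF assms(7) J(2) e(1) F _ S C SC rel])
      (auto simp: k[symmetric])
  have cont: "continuous_on J F" "continuous_on J c" "continuous_on J s"
    using F c s by (auto intro!: DERIV_continuous_on[OF DERIV_subset])
  have "(\<forall>u\<in>J. F u * c u - e * s u = 0) \<or> (\<forall>u\<in>J. F u * s u - c u = 0)"
  proof (rule product_zero_dichotomy[OF J(1)])
    show "(F u * c u - e * s u) * (F u * s u - c u) = 0" if "u \<in> J" for u
    proof -
      \<comment> \<open>For \<open>k\<close> = \<open>e\<close> the relation reads (F^2 + e) S = 2 F
        C; expanding \<open>S\<close> and \<open>C\<close> gives twice the product.\<close>
      have "2 * ((F u * c u - e * s u) * (F u * s u - c u)) = 0"
        using rel[OF that] unfolding \<open>k = e\<close> S_def C_def by algebra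
      then show ?thesis by simp
    qed
    show "F u * c u - e * s u \<noteq> 0 \<or> F u * s u - c u \<noteq> 0" for u
    proof (rule ccontr)
      assume "\<not> ?thesis"
      then have "F u * c u = e * s u" "F u * s u = c u" by simp_all
      \<comment> \<open>A common zero gives c c = F s c = e s s.\<close>
      then have "(c u)\<^sup>2 - e * (s u)\<^sup>2 = 0" by algebra
      then show False using cs[of u] by simp
    qed
  qed (intro continuous_intros cont)+
  then show ?thesis
  proof (elim disjE)
    assume A: "\<forall>u\<in>J. F u * c u - e * s u = 0"
    have "cosh (\<kappa> * of_real v) \<noteq> 0 \<and> of_real (F v) = \<kappa> * tanh (\<kappa> * of_real v)"
      if "v \<in> J" for v
    proof -
      have eq: "F v * c v = e * s v" using A that by simp
      have "c v \<noteq> 0"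
      proof
        assume "c v = 0"
        then have "e * s v = 0" using eq by simp
        then show False using cs[of v] \<open>c v = 0\<close> by auto
      qed
      moreover have "\<kappa> * tanh (\<kappa> * of_real v) = \<kappa>\<^sup>2 * of_real (s v) / of_real (c v)"
        by (simp add: tanh_def cosh sinh power2_eq_square)
      moreover have "F v = e * s v / c v" using eq \<open>c v \<noteq> 0\<close> by (simp add: field_simps)
      ultimately show ?thesis by (simp add: cosh e)
    qed
    then show ?thesis by blast
  next
    assume B: "\<forall>u\<in>J. F u * s u - c u = 0"
    have "sinh (\<kappa> * of_real v) \<noteq> 0 \<and> of_real (F v) = \<kappa> * coth (\<kappa> * of_real v)"
      if "v \<in> J" for v
    proof -
      have eq: "F v * s v = c v" using B that by simp
      have "s v \<noteq> 0"
      proof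
        assume "s v = 0"
        then show False using cs[of v] eq by auto
      qed
      moreover have "F v = c v / s v" using eq \<open>s v \<noteq> 0\<close> by (simp add: field_simps)
      ultimately show ?thesis using \<kappa> by (simp add: coth_def cosh sinh)
    qed
    then show ?thesis by blast
  qed
qed

end
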